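(* Let $\mathcal{H}$ be a nonzero right quaternionic Hilbert space, let $T\in\mathcal{B}(\mathcal{H})$ be normal (i.e. $TT^*=T^*T$) and let $\varepsilon>0$. Then $$S^{\mathbb{H}}(\sigma_S(T),\varepsilon)=\Lambda_\varepsilon^S(T).$$
   Context: $\mathbb{H}$ is the division ring of real quaternions, with $\mathbb{C}=\mathbb{R}+\mathbb{R}i\subset\mathbb{H}$; $\mathrm{Re}(q)$ and $|q|$ denote the real part and modulus of $q\in\mathbb{H}$. A right quaternionic Hilbert space is a right $\mathbb{H}$-module with an $\mathbb{H}$-valued inner product (positive definite, right $\mathbb{H}$-linear in the second variable, $\langle x,y\rangle=\overline{\langle y,x\rangle}$), complete in the induced norm. $\mathcal{B}(\mathcal{H})$ is the real Banach algebra of bounded right $\mathbb{H}$-linear operators on $\mathcal{H}$ with the operator norm; $T^*$ is the adjoint of $T$. For $T\in\mathcal{B}(\mathcal{H})$ and $q\in\mathbb{H}$ put $Q_q(T)=T^2-2\,\mathrm{Re}(q)T+|q|^2I$. The $S$-spectrum is $\sigma_S(T)=\{q\in\mathbb{H}: Q_q(T)\text{ is not invertible in }\mathcal{B}(\mathcal{H})\}$ (a non-empty compact set). For $\varepsilon>0$ the pseudo $S$-spectrum is $\Lambda_\varepsilon^S(T)=\sigma_S(T)\cup\{q\in\mathbb{H}\setminus\sigma_S(T): \|Q_q(T)^{-1}\|\ge 1/\varepsilon\}$. For a compact set $K\subseteq\mathbb{H}$ and $\varepsilon>0$, the $\varepsilon$-sphere around $K$ is $S^{\mathbb{H}}(K,\varepsilon)=\{q\in\mathbb{H}:\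 \inf_{\mu\in K\cap\mathbb{C}}|\mu^2-2\mathrm{Re}(q)\mu+|q|^2|\le\varepsilon\}$. *)

theory Defs
  imports "HOL-Analysis.Analysis"
begin

section \<open>The division ring of real quaternions\<close>

datatype quat = Quat (qRe: real) (qI: real) (qJ: real) (qK: real)

lemma quat_eqI: "qRe p = qRe q \<Longrightarrow> qI p = qI q \<Longrightarrow> qJ p = qJ q \<Longrightarrow> qK p = qK q \<Longrightarrow> p = q"
  by (rule quat.expand) simp

lemma quat_eq_iff: "p = q \<longleftrightarrow> qRe p = qRe q \<and> qI p = qI q \<and> qJ p = qJ q \<and> qK p = qK q"
  by (auto intro: quat_eqI)

definition qcnj :: "quat \<Rightarrow> quat" where
  "qcnj q = Quat (qRe q) (- qI q) (- qJ q) (- qK q)"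

instantiation quat :: real_vector
begin

definition "0 = Quat 0 0 0 0"
definition "p + q = Quat (qRe p + qRe q) (qI p + qI q) (qJ p + qJ q) (qK p + qK q)"
definition "- q = Quat (- qRe q) (- qI q) (- qJ q) (- qK q)"
definition "p - q = Quat (qRe p - qRe q) (qI p - qI q) (qJ p - qJ q) (qK p - qK q)"
definition "r *\<^sub>R q = Quat (r * qRe q) (r * qI q) (r * qJ q) (r * qK q)"
instance
  by standard (auto simp: zero_quat_def plus_quat_def uminus_quat_def minus_quat_def
      scaleR_quat_def quat_eq_iff algebra_simps)

end

instantiation quat :: real_inner
begin

definition "p \<bullet> q = qRe p * qRe q + qI p * qI q + qJ p * qJ q + qK p * qK q"
definition "norm q = sqrt ((qRe q)\<^sup>2 + (qI q)\<^sup>2 + (qJ q)\<^sup>2 + (qK q)\<^sup>2)"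
definition "sgn (q::quat) = q /\<^sub>R norm q"
definition "dist (p::quat) q = norm (p - q)"
definition [code del]:
  "(uniformity :: (quat \<times> quat) filter) = (INF e\<in>{0 <..}. principal {(x, y). dist x y < e})"
definition [code del]:
  "open (U :: quat set) \<longleftrightarrow> (\<forall>x\<in>U. eventually (\<lambda>(x', y). x' = x \<longrightarrow> y \<in> U) uniformity)"

instance
proof
  fix x :: quat
  show "x \<bullet> x = 0 \<longleftrightarrow> x = 0"
    by (auto simp: inner_quat_def zero_quat_def quat_eq_iff add_nonneg_eq_0_iff)
qed (auto simp: zero_quat_def plus_quat_def uminus_quat_def minus_quat_def scaleR_quat_def
      inner_quat_def norm_quat_def sgn_quat_def dist_quat_def uniformity_quat_def open_quat_def
      quat_eq_iff algebra_simps power2_eq_square)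

end

instantiation quat :: real_normed_div_algebra
begin

definition "1 = Quat 1 0 0 0"
definition "p * q = Quat
  (qRe p * qRe q - qI p * qI q - qJ p * qJ q - qK p * qK q)
  (qRe p * qI q + qI p * qRe q + qJ p * qK q - qK p * qJ q)
  (qRe p * qJ q - qI p * qK q + qJ p * qRe q + qK p * qI q)
  (qRe p * qK q + qI p * qJ q - qJ p * qI q + qK p * qRe q)"
definition "inverse q = qcnj q /\<^sub>R (norm q)\<^sup>2"
definition "p div (q::quat) = p * inverse q"

instance
proof
  fix x y :: quat
  have nz: "(qRe x)\<^sup>2 + (qI x)\<^sup>2 + (qJ x)\<^sup>2 + (qK x)\<^sup>2 \<noteq> 0" if "x \<noteq> 0"
    using that by (auto simp: quat_eq_iff zero_quat_def add_nonneg_eq_0_iff)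
  show "inverse x * x = 1" if "x \<noteq> 0"
    using nz[OF that]
    by (simp add: quat_eq_iff times_quat_def inverse_quat_def one_quat_def qcnj_def
        scaleR_quat_def norm_quat_def divide_simps) (auto simp: algebra_simps power2_eq_square)
  show "x * inverse x = 1" if "x \<noteq> 0"
    using nz[OF that]
    by (simp add: quat_eq_iff times_quat_def inverse_quat_def one_quat_def qcnj_def
        scaleR_quat_def norm_quat_def divide_simps) (auto simp: algebra_simps power2_eq_square)
  show "norm (x * y) = norm x * norm y"
    unfolding norm_quat_def real_sqrt_mult[symmetric]
    by (rule arg_cong[of _ _ sqrt]) (simp add: times_quat_def power2_eq_square algebra_simps)
qed (auto simp: zero_quat_def plus_quat_def one_quat_def times_quat_def scaleR_quat_def
      quat_eq_iff algebra_simps inverse_quat_def divide_quat_def qcnj_def)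

end

lemma of_real_quat: "(of_real r :: quat) = Quat r 0 0 0"
  by (simp add: of_real_def scaleR_quat_def one_quat_def)

lemma mult_qcnj: "q * qcnj q = of_real ((norm q)\<^sup>2)"
  by (simp add: of_real_quat times_quat_def qcnj_def norm_quat_def power2_eq_square)

instance quat :: complete_space
proof
  fix X :: "nat \<Rightarrow> quat"
  assume X: "Cauchy X"
  have comp: "convergent (\<lambda>n. f (X n))"
    if "\<And>p q. \<bar>f p - f q\<bar> \<le> norm (p - q)" for f :: "quat \<Rightarrow> real"
  proof -
    have "Cauchy (\<lambda>n. f (X n))"
    proof (rule metric_CauchyI)
      fix e :: real assume "0 < e"
      with X obtain M where "\<forall>m\<ge>M. \<forall>n\<ge>M. dist (X m) (X n) < e"
        by (auto simp: Cauchy_def)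
      then show "\<exists>M. \<forall>m\<ge>M. \<forall>n\<ge>M. dist (f (X m)) (f (X n)) < e"
        using that by (metis dist_norm dist_real_def le_less_trans)
    qed
    then show ?thesis by (rule Cauchy_convergent)
  qed
  have "\<bar>qRe p - qRe q\<bar> \<le> norm (p - q)" "\<bar>qI p - qI q\<bar> \<le> norm (p - q)"
    "\<bar>qJ p - qJ q\<bar> \<le> norm (p - q)" "\<bar>qK p - qK q\<bar> \<le> norm (p - q)" for p q
    by (auto simp: norm_quat_def minus_quat_def intro!: real_le_rsqrt)
  then obtain a b c d where
    lim: "(\<lambda>n. qRe (X n)) \<longlonglongrightarrow> a" "(\<lambda>n. qI (X n)) \<longlonglongrightarrow> b"
      "(\<lambda>n. qJ (X n)) \<longlonglongrightarrow> c" "(\<lambda>n. qK (X n)) \<longlonglongrightarrow> d"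
    using comp[of qRe] comp[of qI] comp[of qJ] comp[of qK] unfolding convergent_def by blast
  have "(\<lambda>n. sqrt ((qRe (X n) - a)\<^sup>2 + (qI (X n) - b)\<^sup>2 + (qJ (X n) - c)\<^sup>2 + (qK (X n) - d)\<^sup>2))
      \<longlonglongrightarrow> sqrt ((a - a)\<^sup>2 + (b - b)\<^sup>2 + (c - c)\<^sup>2 + (d - d)\<^sup>2)"
    by (intro tendsto_intros lim)
  then have "(\<lambda>n. dist (X n) (Quat a b c d)) \<longlonglongrightarrow> 0"
    by (simp add: dist_quat_def norm_quat_def minus_quat_def)
  then show "convergent X"
    unfolding convergent_def using tendsto_dist_iff by blast
qed

text \<open>The copy \<open>\<real> + \<real>i\<close> of the complex numbers inside the quaternions.\<close>

definition qcomplex :: "quat set" where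
  "qcomplex = {q. qJ q = 0 \<and> qK q = 0}"


section \<open>Right quaternionic Hilbert spaces\<close>

class right_quat_module = real_vector +
  fixes scaleQ :: "'a \<Rightarrow> quat \<Rightarrow> 'a"  (infixl "\<odot>" 75)
  assumes scaleQ_add_left: "(x + y) \<odot> q = x \<odot> q + y \<odot> q"
    and scaleQ_add_right: "x \<odot> (p + q) = x \<odot> p + x \<odot> q"
    and scaleQ_scaleQ: "(x \<odot> p) \<odot> q = x \<odot> (p * q)"
    and scaleQ_one: "x \<odot> 1 = x"
    and scaleR_eq_scaleQ: "r *\<^sub>R x = x \<odot> of_real r"

text \<open>The real vector space structure and the real inner product (hence the norm, the metric and the
  topology) of the class below are those induced by the quaternionic data, as the axioms
  \<open>scaleR_eq_scaleQ\<close> and \<open>inner_eq_qRe_qinner\<close> require; they are not additional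
  structure, and serve to make the library's notions of completeness, bounded operators and
  operator norm available.\<close>

class quat_hilbert_space = right_quat_module + real_inner + complete_space +
  fixes qinner :: "'a \<Rightarrow> 'a \<Rightarrow> quat"
  assumes qinner_add_right: "qinner x (y + z) = qinner x y + qinner x z"
    and qinner_scaleQ_right: "qinner x (y \<odot> q) = qinner x y * q"
    and qinner_commute: "qinner x y = qcnj (qinner y x)"
    and qinner_ge_zero: "0 \<le> qRe (qinner x x)"
    and qinner_eq_zero_iff: "qinner x x = 0 \<longleftrightarrow> x = 0"
    and inner_eq_qRe_qinner: "x \<bullet> y = qRe (qinner x y)"

lemma qinner_self: "qinner x x = of_real ((norm x)\<^sup>2)"
proof -
  have "qinner x x = qcnj (qinner x x)" by (rule qinner_commute)
  then show ?thesis
    by (simp add: quat_eq_iff qcnj_def of_real_quat power2_norm_eq_inner inner_eq_qRe_qinner)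
qed

instantiation quat :: quat_hilbert_space
begin

definition "(x::quat) \<odot> q = x * q"
definition "qinner x (y::quat) = qcnj x * y"

instance
  by standard (auto simp: scaleQ_quat_def qinner_quat_def algebra_simps of_real_quat
      scaleR_quat_def times_quat_def qcnj_def quat_eq_iff inner_quat_def zero_quat_def
      plus_quat_def one_quat_def add_nonneg_eq_0_iff)

end


section \<open>Bounded right quaternionic linear operators\<close>

definition quat_ops :: "('a::quat_hilbert_space \<Rightarrow>\<^sub>L 'a) set" where
  "quat_ops = {T. \<forall>x q. blinfun_apply T (x \<odot> q) = blinfun_apply T x \<odot> q}"

definition is_qadjoint :: "('a::quat_hilbert_space \<Rightarrow>\<^sub>L 'a) \<Rightarrow> ('a \<Rightarrow>\<^sub>L 'a) \<Rightarrow> bool" where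
  "is_qadjoint T S \<longleftrightarrow>
     S \<in> quat_ops \<and> (\<forall>x y. qinner (blinfun_apply S x) y = qinner x (blinfun_apply T y))"

definition qadjoint :: "('a::quat_hilbert_space \<Rightarrow>\<^sub>L 'a) \<Rightarrow> ('a \<Rightarrow>\<^sub>L 'a)" where
  "qadjoint T = (THE S. is_qadjoint T S)"

lemma is_qadjoint_unique:
  assumes "is_qadjoint T S" "is_qadjoint T S'"
  shows "S = S'"
proof (rule blinfun_eqI)
  fix x
  have "qinner (blinfun_apply S x) y = qinner (blinfun_apply S' x) y" for y
    using assms by (simp add: is_qadjoint_def)
  then have "blinfun_apply S x \<bullet> y = blinfun_apply S' x \<bullet> y" for y
    by (simp add: inner_eq_qRe_qinner)
  then show "blinfun_apply S x = blinfun_apply S' x"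
    using vector_eq_rdot by blast
qed

definition qnormal :: "('a::quat_hilbert_space \<Rightarrow>\<^sub>L 'a) \<Rightarrow> bool" where
  "qnormal T \<longleftrightarrow> T o\<^sub>L qadjoint T = qadjoint T o\<^sub>L T"

definition is_op_inverse :: "('a::quat_hilbert_space \<Rightarrow>\<^sub>L 'a) \<Rightarrow> ('a \<Rightarrow>\<^sub>L 'a) \<Rightarrow> bool" where
  "is_op_inverse A B \<longleftrightarrow> B \<in> quat_ops \<and> A o\<^sub>L B = id_blinfun \<and> B o\<^sub>L A = id_blinfun"

definition op_invertible :: "('a::quat_hilbert_space \<Rightarrow>\<^sub>L 'a) \<Rightarrow> bool" where
  "op_invertible A \<longleftrightarrow> (\<exists>B. is_op_inverse A B)"

definition op_inverse :: "('a::quat_hilbert_space \<Rightarrow>\<^sub>L 'a) \<Rightarrow> ('a \<Rightarrow>\<^sub>L 'a)" where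
  "op_inverse A = (THE B. is_op_inverse A B)"

lemma op_inverse_eq:
  assumes "is_op_inverse A B"
  shows "op_inverse A = B"
  unfolding op_inverse_def
proof (rule the_equality)
  fix C assume C: "is_op_inverse A C"
  have "C = C o\<^sub>L (A o\<^sub>L B)"
    using assms by (simp add: is_op_inverse_def blinfun_eqI)
  also have "\<dots> = (C o\<^sub>L A) o\<^sub>L B"
    by (simp add: blinfun_eqI)
  also have "\<dots> = B"
    using C by (simp add: is_op_inverse_def blinfun_eqI)
  finally show "C = B" .
qed (rule assms)


section \<open>S-spectrum, pseudo S-spectrum and spheres\<close>

definition Qop :: "quat \<Rightarrow> ('a::quat_hilbert_space \<Rightarrow>\<^sub>L 'a) \<Rightarrow> ('a \<Rightarrow>\<^sub>L 'a)" where
  "Qop q T = (T o\<^sub>L T) - (2 * qRe q) *\<^sub>R T + (norm q)\<^sup>2 *\<^sub>R id_blinfun"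

definition S_spectrum :: "('a::quat_hilbert_space \<Rightarrow>\<^sub>L 'a) \<Rightarrow> quat set" where
  "S_spectrum T = {q. \<not> op_invertible (Qop q T)}"

definition pseudo_S_spectrum :: "real \<Rightarrow> ('a::quat_hilbert_space \<Rightarrow>\<^sub>L 'a) \<Rightarrow> quat set" where
  "pseudo_S_spectrum \<epsilon> T =
     S_spectrum T \<union> {q \<in> - S_spectrum T. norm (op_inverse (Qop q T)) \<ge> 1 / \<epsilon>}"

text \<open>The infimum is taken in the extended reals, so that it is \<open>\<infinity>\<close> when \<open>K\<close> contains no complex
  numbers.\<close>

definition S_sphere :: "quat set \<Rightarrow> real \<Rightarrow> quat set" where
  "S_sphere K \<epsilon> =
     {q. (INF \<mu>\<in>K \<inter> qcomplex. ereal (norm (\<mu>\<^sup>2 - (2 * qRe q) *\<^sub>R \<mu> + of_real ((norm q)\<^sup>2))))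
           \<le> ereal \<epsilon>}"

end

theory Submission
  imports Defs
begin

text \<open>
  Up to the existence of the adjoint \<open>T'\<close> (Riesz), invertibility and norms are questions about the
  underlying real Hilbert space, where a normal operator is invertible iff it is bounded below.
  Put \<open>p(z) = z\<^sup>2 - 2 Re(q) z + |q|\<^sup>2\<close>, so that \<open>Q\<^sub>q(T) = p(T)\<close>.

  If \<open>\<mu>\<close> lies in the spectrum, the factorisation of \<open>Q\<^sub>\<mu>(T)\<close> through \<open>x \<mapsto> T x - x \<mu>\<close> and
  \<open>x \<mapsto> T x - x \<mu>\<^sup>*\<close> (with \<open>\<mu>\<^sup>*\<close> the conjugate) yields approximate right eigenvectors of \<open>T\<close>, hence of
  \<open>p(T)\<close>, and \<open>|p(\<mu>)| \<ge> 1 / \<parallel>p(T)\<^sup>-\<^sup>1\<parallel>\<close>.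

  Conversely, let \<open>N = p(T)\<^sup>-\<^sup>1\<close>. Maximising first \<open>\<parallel>N x\<parallel>\<close>, then \<open>\<parallel>T x\<parallel>\<close>, then \<open>\<parallel>(T + 1) x\<parallel>\<close>, each
  time among the approximate eigenvectors found so far, gives unit vectors with
  \<open>N' N x \<approx> \<parallel>N\<parallel>\<^sup>2 x\<close>, \<open>T' T x \<approx> s x\<close> and \<open>(T + T') x \<approx> 2 a x\<close>. Then \<open>T\<^sup>2 x - 2 a T x + s x \<approx> 0\<close>, so
  \<open>\<mu> = a + i (s - a\<^sup>2)\<^sup>1\<^sup>/\<^sup>2\<close> is in the spectrum, and \<open>|p(\<mu>)| = \<parallel>p(T) x\<parallel> = 1 / \<parallel>N\<parallel>\<close> in the limit.
\<close>

section \<open>Riesz representation and real adjoints\<close>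

text \<open>The representing vector is the minimiser of \<open>\<parallel>x\<parallel>\<^sup>2 - 2 f x\<close>.\<close>

lemma riesz_representation_real:
  fixes f :: "'a::{real_inner,complete_space} \<Rightarrow> real"
  assumes "bounded_linear f"
  obtains z where "\<And>y. f y = z \<bullet> y"
proof -
  interpret f: bounded_linear f by (rule assms)
  obtain K where K: "\<And>x. norm (f x) \<le> norm x * K"
    using f.bounded by blast
  define J where "J x = x \<bullet> x - 2 * f x" for x
  have low: "- K\<^sup>2 \<le> J x" for x
  proof -
    have "f x \<le> norm x * K" using K[of x] by simp
    moreover have "0 \<le> (norm x - K)\<^sup>2" by simp
    ultimately show ?thesis
      by (simp add: J_def power2_diff flip: power2_norm_eq_inner)
  qed
  define d where "d = (INF x. J x)"
  have bdd: "bdd_below (range J)" using low by (rule bdd_belowI2)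
  have d_le: "d \<le> J x" for x unfolding d_def by (rule cINF_lower[OF bdd]) simp
  have "\<exists>x. J x < d + inverse (real (Suc n))" for n
    using cINF_less_iff[OF _ bdd, of "d + inverse (real (Suc n))"] by (simp add: d_def)
  then obtain X where X: "\<And>n. J (X n) < d + inverse (real (Suc n))" by metis
  \<comment> \<open>Parallelogram law at the midpoint: near-minimisers lie close together, so
    \<open>X\<close> is Cauchy.\<close>
  have par: "(norm (x - y))\<^sup>2 \<le> 2 * (J x - d) + 2 * (J y - d)" for x y
  proof -
    have "(norm (x - y))\<^sup>2 = 2 * J x + 2 * J y - 4 * J ((1/2) *\<^sub>R (x + y))"
      by (simp add: J_def power2_norm_eq_inner f.add f.diff f.scaleR inner_add inner_diff inner_commute algebra_simps)
    then show ?thesis using d_le[of "(1/2) *\<^sub>R (x + y)"] by simp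
  qed
  have "Cauchy X"
  proof (rule metric_CauchyI)
    fix e :: real assume "0 < e"
    then obtain M where M: "inverse (real (Suc M)) < e\<^sup>2 / 4"
      using reals_Archimedean[of "e\<^sup>2 / 4"] by auto
    have "dist (X m) (X n) < e" if "m \<ge> M" "n \<ge> M" for m n
    proof -
      have "inverse (real (Suc k)) \<le> inverse (real (Suc M))" if "k \<ge> M" for k
        using that by (intro le_imp_inverse_le) auto
      then have *: "J (X k) - d < e\<^sup>2 / 4" if "k \<ge> M" for k
        using M X[of k] that by (smt (verit))
      have "(norm (X m - X n))\<^sup>2 < e\<^sup>2"
        using add_strict_mono[OF *[OF that(1)] *[OF that(2)]] par[of "X m" "X n"] by simp
      then show ?thesis
        using \<open>0 < e\<close> by (simp add: dist_norm power_less_imp_less_base)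
    qed
    then show "\<exists>M. \<forall>m\<ge>M. \<forall>n\<ge>M. dist (X m) (X n) < e" by blast
  qed
  then obtain z where z: "X \<longlonglongrightarrow> z"
    using Cauchy_convergent convergent_def by blast
  have "(\<lambda>n. J (X n)) \<longlonglongrightarrow> J z"
    unfolding J_def by (intro tendsto_intros z f.tendsto)
  moreover have "(\<lambda>n. d + inverse (real (Suc n))) \<longlonglongrightarrow> d"
    using tendsto_add[OF tendsto_const LIMSEQ_inverse_real_of_nat, of d] by simp
  ultimately have Jz: "J z \<le> d"
    by (rule LIMSEQ_le) (use X less_imp_le in blast)
  have "f y = z \<bullet> y" for y
  proof -
    define c where "c = z \<bullet> y - f y"
    \<comment> \<open>Minimality of \<open>z\<close> against \<open>z - t *\<^sub>R y\<close> gives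
      \<open>0 \<le> t * (t * (y \<bullet> y) - 2 * c)\<close>. This \<open>t\<close> turns it into
      t c + t^2 \<le> 0 with t c \<ge> 0, so t = 0. The summand 1 covers
      \<open>y = 0\<close>.\<close>
    define t where "t = c / (y \<bullet> y + 1)"
    have pos: "0 < y \<bullet> y + 1" by (simp add: add_nonneg_pos)
    have "J z \<le> J (z - t *\<^sub>R y)" using Jz d_le order_trans by blast
    then have "0 \<le> t * (t * (y \<bullet> y) - 2 * c)"
      by (simp add: J_def f.diff f.scaleR inner_diff inner_commute c_def algebra_simps)
    also have "t * (y \<bullet> y) = c - t"
      using pos by (simp add: t_def field_simps)
    finally have "t * c + t\<^sup>2 \<le> 0" by (simp add: algebra_simps power2_eq_square)
    moreover have "0 \<le> t * c" using pos by (simp add: t_def)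
    ultimately have "t = 0" by (smt (verit) zero_le_power2 zero_eq_power2)
    then show ?thesis using pos by (simp add: t_def c_def)
  qed
  then show thesis by (rule that)
qed

lemma adjoint_exists:
  fixes T :: "'a::{real_inner,complete_space} \<Rightarrow>\<^sub>L 'a"
  obtains S :: "'a \<Rightarrow>\<^sub>L 'a" where "\<And>x y. S x \<bullet> y = x \<bullet> T y"
proof -
  have "\<exists>z. \<forall>y. x \<bullet> T y = z \<bullet> y" for x
    using riesz_representation_real[of "\<lambda>y. x \<bullet> T y"]
    by (metis bounded_linear_inner_right_comp blinfun.bounded_linear_right)
  then obtain S where S: "\<And>x y. x \<bullet> T y = S x \<bullet> y" by metis
  have "bounded_linear S"
  proof (rule bounded_linear_intro[of _ "norm T"])
    show "S (x + y) = S x + S y" for x y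
      by (subst vector_eq_rdot[symmetric]) (simp add: inner_add_left flip: S)
    show "S (r *\<^sub>R x) = r *\<^sub>R S x" for r x
      by (subst vector_eq_rdot[symmetric]) (simp flip: S)
    show "norm (S x) \<le> norm x * norm T" for x
    proof -
      have "norm (S x) * norm (S x) = x \<bullet> T (S x)"
        by (simp add: S flip: power2_norm_eq_inner power2_eq_square)
      also have "\<dots> \<le> norm x * (norm T * norm (S x))"
        by (meson Cauchy_Schwarz_ineq2 abs_le_D1 mult_left_mono norm_blinfun norm_ge_zero order_trans)
      finally show ?thesis
        by (cases "S x = 0") (auto simp: mult.assoc[symmetric])
    qed
  qed
  then show thesis
    using that[of "Blinfun S"] by (simp add: bounded_linear_Blinfun_apply S)
qed

section \<open>Quaternionic inner product and adjoint\<close>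

lemma qinner_scaleQ_left: "qinner (x \<odot> q) y = qcnj q * qinner (x::'a::quat_hilbert_space) y"
  by (subst (1 2) qinner_commute)
     (simp add: qinner_scaleQ_right qcnj_def times_quat_def algebra_simps)

text \<open>Pairing with the right multiples by 1, i, j, k reads off all four coordinates from real
  parts. This lifts real adjoint identities to quaternionic ones.\<close>

lemma qinner_eqI:
  fixes u v y w :: "'a::quat_hilbert_space"
  assumes "\<And>q. u \<bullet> (y \<odot> q) = v \<bullet> (w \<odot> q)"
  shows "qinner u y = qinner v w"
proof -
  have "qRe (qinner u y * q) = qRe (qinner v w * q)" for q
    using assms[of q] by (simp add: inner_eq_qRe_qinner qinner_scaleQ_right)
  from this[of "Quat 1 0 0 0"] this[of "Quat 0 1 0 0"] this[of "Quat 0 0 1 0"] this[of "Quat 0 0 0 1"]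
  show ?thesis by (simp add: times_quat_def quat_eq_iff)
qed

text \<open>The real adjoint is already the quaternionic one: right linearity of \<open>T\<close>
  lifts the adjoint identity to \<open>qinner\<close>, which in turn makes \<open>S\<close> right
  linear.\<close>

lemma is_qadjoint_qadjoint:
  assumes "T \<in> quat_ops"
  shows "is_qadjoint T (qadjoint T)"
proof -
  obtain S :: "'a \<Rightarrow>\<^sub>L 'a" where S: "\<And>x y. S x \<bullet> y = x \<bullet> T y" using adjoint_exists[of T] by blast
  have *: "qinner (S x) y = qinner x (T y)" for x y
    using assms by (intro qinner_eqI) (simp add: S quat_ops_def)
  have "S (x \<odot> q) \<bullet> y = (S x \<odot> q) \<bullet> y" for x :: 'a and q y
    by (simp add: inner_eq_qRe_qinner * qinner_scaleQ_left)
  then have "is_qadjoint T S"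
    using * vector_eq_rdot unfolding is_qadjoint_def quat_ops_def by blast
  then show ?thesis
    unfolding qadjoint_def using is_qadjoint_unique theI[of "is_qadjoint T"] by blast
qed

lemma norm_scaleQ: "norm (x \<odot> q) = norm (x::'a::quat_hilbert_space) * norm q"
proof -
  have "qRe (qinner (x \<odot> q) (x \<odot> q)) = (norm x)\<^sup>2 * ((qRe q)\<^sup>2 + (qI q)\<^sup>2 + (qJ q)\<^sup>2 + (qK q)\<^sup>2)"
    unfolding qinner_scaleQ_left qinner_scaleQ_right unfolding qinner_self of_real_quat
    by (simp add: times_quat_def qcnj_def algebra_simps power2_eq_square)
  then have "(norm (x \<odot> q))\<^sup>2 = (norm x * norm q)\<^sup>2"
    by (simp only: power2_norm_eq_inner[of "x \<odot> q"] inner_eq_qRe_qinner)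
       (simp add: norm_quat_def power_mult_distrib)
  then show ?thesis by simp
qed

section \<open>Invertibility of normal operators\<close>

lemma normal_norm_adjoint:
  assumes "\<And>x y. S x \<bullet> y = x \<bullet> T y" "\<And>x. T (S x) = S (T x)"
  shows "norm (S x) = norm (T (x::'a::real_inner))"
proof -
  have "S x \<bullet> S x = S (T x) \<bullet> x" by (simp add: assms inner_commute)
  then show ?thesis by (simp add: norm_eq_sqrt_inner assms(1))
qed

text \<open>For small \<open>t > 0\<close> the map \<open>x \<mapsto> x - t (B (A x) - y)\<close> is a contraction.\<close>

lemma normal_bounded_below_surj:
  fixes A B :: "'a::{real_inner,complete_space} \<Rightarrow>\<^sub>L 'a"
  assumes adj: "\<And>x y. B x \<bullet> y = x \<bullet> A y" and comm: "\<And>x. A (B x) = B (A x)"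
    and c: "0 < c" "\<And>x. c * norm x \<le> norm (A x)"
  shows "\<exists>x. A x = y"
proof (cases "\<exists>x::'a. x \<noteq> 0")
  case False
  then show ?thesis by metis
next
  case True
  define k where "k = norm (B o\<^sub>L A)"
  obtain u :: 'a where u: "norm u = 1" using True by (metis norm_sgn)
  have kb: "norm (B (A x)) \<le> k * norm x" for x
    using norm_blinfun[of "B o\<^sub>L A" x] by (simp add: k_def)
  have Bc: "c * norm x \<le> norm (B x)" for x
    using c(2) normal_norm_adjoint[of B A, OF adj comm] by simp
  have "0 < c * c" using c(1) by simp
  also have "c * c \<le> c * norm (A u)" using c(1) c(2)[of u] u by simp
  also have "\<dots> \<le> norm (B (A u))" by (rule Bc)
  also have "\<dots> \<le> k" using kb[of u] u by simp
  finally have k0: "0 < k" .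
  \<comment> \<open>This \<open>t\<close> minimises 1 - 2 t c^2 + t^2 k^2, with minimum 1 - c^4 /
    k^2. The \<open>max\<close> in \<open>r\<close> keeps the root nonnegative without comparing c^2
    with k.\<close>
  define t where "t = c\<^sup>2 / k\<^sup>2"
  define F where "F x = x - t *\<^sub>R (B (A x) - y)" for x
  define r where "r = sqrt (max 0 (1 - c ^ 4 / k\<^sup>2))"
  have "0 < c ^ 4 / k\<^sup>2" using c(1) k0 by simp
  then have r: "0 \<le> r" "r < 1" by (auto simp: r_def)
  have lip: "norm (F x - F w) \<le> r * norm (x - w)" for x w
  proof -
    define v where "v = x - w"
    have "F x - F w = v - t *\<^sub>R B (A v)"
      by (simp add: F_def v_def blinfun.diff_right algebra_simps)
    then have "(norm (F x - F w))\<^sup>2 = (norm (v - t *\<^sub>R B (A v)))\<^sup>2" by simp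
    also have "\<dots> = (norm v)\<^sup>2 - 2 * t * (norm (A v))\<^sup>2 + t\<^sup>2 * (norm (B (A v)))\<^sup>2"
      using adj[of "A v" v] unfolding power2_norm_eq_inner
      by (simp add: inner_diff inner_commute algebra_simps power2_eq_square)
    also have "\<dots> \<le> (norm v)\<^sup>2 - 2 * t * (c * norm v)\<^sup>2 + t\<^sup>2 * (k * norm v)\<^sup>2"
      using c kb[of v] k0
      by (intro add_mono diff_mono mult_left_mono power_mono) (auto simp: t_def)
    also have "\<dots> = (1 - c ^ 4 / k\<^sup>2) * (norm v)\<^sup>2"
      using k0 by (simp add: t_def field_simps power_mult_distrib power2_eq_square power4_eq_xxxx)
    also have "\<dots> \<le> r\<^sup>2 * (norm v)\<^sup>2" by (intro mult_right_mono) (auto simp: r_def)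
    finally show ?thesis
      using r by (simp add: v_def flip: power_mult_distrib)
  qed
  have "\<exists>!x\<in>UNIV. F x = x"
    by (rule Banach_fix[of UNIV r]) (use r lip in \<open>auto simp: dist_norm complete_UNIV\<close>)
  then obtain x where "F x = x" by blast
  then have "B (A x) = y" using c(1) k0 by (simp add: F_def t_def)
  \<comment> \<open>By commutation \<open>B x\<close> is the required preimage.\<close>
  then show ?thesis using comm by metis
qed

text \<open>The lower bound gives injectivity, which transfers linearity and right linearity to the
  set-theoretic inverse, and also the norm bound \<open>1 / c\<close>.\<close>

lemma op_invertibleI:
  fixes A :: "'a::quat_hilbert_space \<Rightarrow>\<^sub>L 'a"
  assumes A: "A \<in> quat_ops" and c: "0 < c" "\<And>x. c * norm x \<le> norm (A x)"
    and surj: "\<And>y. \<exists>x. A x = y"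
  shows "op_invertible A"
proof -
  obtain g where g: "\<And>y. A (g y) = y" using surj by metis
  have inj: "x = y" if "A x = A y" for x y
    using c(2)[of "x - y"] c(1) that by (simp add: blinfun.diff_right mult_le_0_iff)
  have "bounded_linear g"
  proof (rule bounded_linear_intro[of _ "1 / c"])
    show "g (x + y) = g x + g y" for x y
      by (rule inj) (simp add: g blinfun.add_right)
    show "g (r *\<^sub>R x) = r *\<^sub>R g x" for r x
      by (rule inj) (simp add: g blinfun.scaleR_right)
    show "norm (g x) \<le> norm x * (1 / c)" for x
      using c(2)[of "g x"] c(1) by (simp add: g field_simps)
  qed
  moreover have "g (A x) = x" for x
    by (rule inj) (simp add: g)
  moreover have "g (x \<odot> q) = g x \<odot> q" for x q
    by (rule inj) (use A in \<open>simp add: g quat_ops_def\<close>)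
  ultimately have "is_op_inverse A (Blinfun g)"
    by (auto simp: is_op_inverse_def quat_ops_def bounded_linear_Blinfun_apply g
        intro!: blinfun_eqI)
  then show ?thesis by (auto simp: op_invertible_def)
qed

section \<open>The operators Q_q(T) and their approximate kernels\<close>

lemma Qop_apply: "Qop q T x = T (T x) - (2 * qRe q) *\<^sub>R T x + (norm q)\<^sup>2 *\<^sub>R x"
  by (simp add: Qop_def blinfun.add_left blinfun.diff_left blinfun.scaleR_left)

lemma scaleQ_diff_left: "(x - y) \<odot> q = x \<odot> q - y \<odot> (q::quat)"
  using scaleQ_add_left[of "x - y" y q] by (simp add: algebra_simps)

lemma scaleQ_diff_right: "x \<odot> (p - q) = x \<odot> p - x \<odot> (q::quat)"
  using scaleQ_add_right[of x "p - q" q] by (simp add: algebra_simps)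

lemma Qop_adjoint:
  fixes S T :: "'a::quat_hilbert_space \<Rightarrow>\<^sub>L 'a"
  assumes "\<And>x y. S x \<bullet> y = x \<bullet> T y"
  shows "Qop q S x \<bullet> y = x \<bullet> Qop q T y"
  by (simp add: Qop_apply inner_add inner_diff assms)

lemma Qop_commute:
  fixes S T :: "'a::quat_hilbert_space \<Rightarrow>\<^sub>L 'a"
  assumes "\<And>x. T (S x) = S (T x)"
  shows "Qop q T (Qop r S x) = Qop r S (Qop q T x)"
  by (simp add: Qop_apply assms blinfun.add_right blinfun.diff_right blinfun.scaleR_right algebra_simps)

lemma Qop_in_quat_ops: "T \<in> quat_ops \<Longrightarrow> Qop q T \<in> quat_ops"
  by (auto simp: quat_ops_def Qop_apply scaleQ_add_left scaleQ_diff_left scaleR_eq_scaleQ scaleQ_scaleQ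
      of_real_quat times_quat_def mult.commute)

text \<open>\<open>Qop q T\<close> is normal with adjoint \<open>Qop q S\<close>, so a lower bound
  already forces surjectivity, and invertibility can fail only through approximate kernel
  vectors.\<close>

lemma not_op_invertible_Qop_iff:
  fixes T S :: "'a::quat_hilbert_space \<Rightarrow>\<^sub>L 'a"
  assumes T: "T \<in> quat_ops" and adj: "\<And>x y. S x \<bullet> y = x \<bullet> T y" and comm: "\<And>x. T (S x) = S (T x)"
  shows "\<not> op_invertible (Qop q T) \<longleftrightarrow> (\<forall>\<delta>>0. \<exists>x. norm x = 1 \<and> norm (Qop q T x) < \<delta>)"
proof
  show "\<forall>\<delta>>0. \<exists>x. norm x = 1 \<and> norm (Qop q T x) < \<delta>" if "\<not> op_invertible (Qop q T)"
  proof (rule ccontr)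
    assume "\<not> ?thesis"
    then obtain c where c: "c > 0" "\<And>x. norm x = 1 \<Longrightarrow> c \<le> norm (Qop q T x)"
      by (auto simp: not_less)
    have bb: "c * norm x \<le> norm (Qop q T x)" for x
      using c(2)[of "x /\<^sub>R norm x"] by (cases "x = 0") (auto simp: blinfun.scaleR_right field_simps)
    have "\<exists>x. Qop q T x = y" for y
      by (rule normal_bounded_below_surj[of "Qop q S" "Qop q T" c])
         (use Qop_adjoint[OF adj] Qop_commute[OF comm] c(1) bb in auto)
    then show False
      using that op_invertibleI[OF Qop_in_quat_ops[OF T] c(1) bb] by blast
  qed
  show "\<not> op_invertible (Qop q T)" if *: "\<forall>\<delta>>0. \<exists>x. norm x = 1 \<and> norm (Qop q T x) < \<delta>"
  proof
    assume "op_invertible (Qop q T)"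
    then obtain B where B: "B o\<^sub>L Qop q T = id_blinfun" by (auto simp: op_invertible_def is_op_inverse_def)
    have pos: "0 < norm B + 1" by (simp add: add_nonneg_pos)
    then obtain x where x: "norm x = 1" "norm (Qop q T x) < 1 / (norm B + 1)"
      using *[rule_format, of "1 / (norm B + 1)"] by auto
    have "x = B (Qop q T x)" using B by (metis blinfun_apply_blinfun_compose blinfun_apply_id_blinfun)
    then have "1 \<le> norm B * norm (Qop q T x)" using norm_blinfun[of B "Qop q T x"] x(1) by simp
    also have "\<dots> \<le> norm B * (1 / (norm B + 1))" using x(2) by (intro mult_left_mono) auto
    also have "\<dots> < 1" using pos by (simp add: field_simps)
    finally show False by simp
  qed
qed

section \<open>Lower bound for |p| on the S-spectrum\<close>

definition sphere_poly :: "quat \<Rightarrow> quat \<Rightarrow> quat" where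
  "sphere_poly q \<mu> = \<mu>\<^sup>2 - (2 * qRe q) *\<^sub>R \<mu> + of_real ((norm q)\<^sup>2)"

text \<open>The coefficients of p are real, so p commutes with conjugation.\<close>

lemma norm_sphere_poly_cnj: "norm (sphere_poly q (qcnj \<mu>)) = norm (sphere_poly q \<mu>)"
proof -
  have "sphere_poly q (qcnj \<mu>) = qcnj (sphere_poly q \<mu>)"
    by (simp add: sphere_poly_def qcnj_def of_real_quat quat_eq_iff power2_eq_square times_quat_def
        plus_quat_def minus_quat_def scaleR_quat_def)
  then show ?thesis by (simp add: norm_quat_def qcnj_def)
qed

text \<open>If both factors of \<open>Qop \<mu> T\<close> were bounded below, so would be their
  product. The factors are only real linear, so the product is expanded by hand.\<close>

lemma approx_right_eigenvalue:
  fixes T :: "'a::quat_hilbert_space \<Rightarrow>\<^sub>L 'a"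
  assumes T: "T \<in> quat_ops"
    and approx: "\<And>\<delta>. 0 < \<delta> \<Longrightarrow> \<exists>x. norm x = 1 \<and> norm (Qop \<mu> T x) < \<delta>"
  obtains \<nu> where "\<nu> = \<mu> \<or> \<nu> = qcnj \<mu>"
    "\<And>c. 0 < c \<Longrightarrow> \<exists>x. norm (T x - x \<odot> \<nu>) < c * norm x"
proof -
  have False if "0 < c" "\<And>x. c * norm x \<le> norm (T x - x \<odot> \<mu>)"
    "0 < d" "\<And>x. d * norm x \<le> norm (T x - x \<odot> qcnj \<mu>)" for c d
  proof -
    have "0 < d * c" using that by simp
    from approx[OF this] obtain x where x: "norm x = 1" "norm (Qop \<mu> T x) < d * c" by blast
    have r: "qcnj \<mu> = of_real (2 * qRe \<mu>) - \<mu>"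
      by (simp add: qcnj_def of_real_quat quat_eq_iff minus_quat_def)
    have "T (T x - x \<odot> \<mu>) - (T x - x \<odot> \<mu>) \<odot> qcnj \<mu>
        = T (T x) - T x \<odot> \<mu> - T x \<odot> qcnj \<mu> + x \<odot> (\<mu> * qcnj \<mu>)"
      using T by (simp add: blinfun.diff_right scaleQ_diff_left scaleQ_scaleQ quat_ops_def)
    also have "\<dots> = Qop \<mu> T x"
      by (simp only: mult_qcnj) (simp add: Qop_apply scaleR_eq_scaleQ r scaleQ_diff_right)
    finally have "Qop \<mu> T x = T (T x - x \<odot> \<mu>) - (T x - x \<odot> \<mu>) \<odot> qcnj \<mu>" ..
    then have "d * norm (T x - x \<odot> \<mu>) \<le> norm (Qop \<mu> T x)" using that(4) by metis
    moreover have "d * c \<le> d * norm (T x - x \<odot> \<mu>)"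
      using that(2)[of x] that(3) x by simp
    ultimately show False using x by simp
  qed
  then show thesis using that by (metis linorder_not_less)
qed

text \<open>An approximate right eigenvector of \<open>T\<close> for \<nu> is one of p(T) for
  p(\<nu>), and \<open>K\<close> limits how far p(T) can shrink it. \<open>K\<close> will be the
  norm of the inverse of p(T).\<close>

lemma norm_sphere_poly_ge:
  fixes T :: "'a::quat_hilbert_space \<Rightarrow>\<^sub>L 'a"
  assumes T: "T \<in> quat_ops"
    and approx: "\<And>\<delta>. 0 < \<delta> \<Longrightarrow> \<exists>x. norm x = 1 \<and> norm (Qop \<mu> T x) < \<delta>"
    and K: "0 \<le> K" "\<And>x. norm x \<le> K * norm (Qop q T x)"
  shows "1 \<le> K * norm (sphere_poly q \<mu>)"
proof -
  obtain \<nu> where \<nu>: "\<nu> = \<mu> \<or> \<nu> = qcnj \<mu>"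
    "\<And>c. 0 < c \<Longrightarrow> \<exists>x. norm (T x - x \<odot> \<nu>) < c * norm x"
    using approx_right_eigenvalue[OF T approx] by blast
  \<comment> \<open>\<open>B\<close> bounds the real linear map
    \<open>y \<mapsto> T y + y \<odot> \<nu> - (2 * qRe q) *\<^sub>R y\<close>; the constant
    \<open>c\<close> below then makes the error K B c at most e.\<close>
  define B where "B = norm T + norm \<nu> + 2 * \<bar>qRe q\<bar>"
  have B: "0 \<le> B" by (simp add: B_def)
  have "1 \<le> K * norm (sphere_poly q \<nu>) + e" if e: "0 < e" for e
  proof -
    define c where "c = e / (K * B + 1)"
    have KB: "0 < K * B + 1" using K B by (simp add: add_nonneg_pos)
    then have "0 < c" using e by (simp add: c_def)
    then obtain x where x: "norm (T x - x \<odot> \<nu>) < c * norm x" using \<nu> by blast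
    define y where "y = T x - x \<odot> \<nu>"
    have x0: "0 < norm x" using x \<open>0 < c\<close> by (metis mult_zero_right norm_ge_zero not_less zero_less_norm_iff norm_zero)
    \<comment> \<open>Analogue of p(T) - p(\<nu>) = (T + \<nu> - 2 Re(q)) (T - \<nu>), with \<nu>
      acting from the right: the error is a bounded map applied to the small vector
      \<open>y\<close>.\<close>
    have "Qop q T x - x \<odot> sphere_poly q \<nu> = T y + y \<odot> \<nu> - (2 * qRe q) *\<^sub>R y"
    proof -
      have "(r *\<^sub>R z) \<odot> \<nu> = r *\<^sub>R (z \<odot> \<nu>)" for r and z :: 'a
        by (simp add: scaleR_eq_scaleQ scaleQ_scaleQ of_real_quat times_quat_def mult.commute)
      moreover have "x \<odot> (r *\<^sub>R \<nu>) = r *\<^sub>R (x \<odot> \<nu>)" for r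
        by (simp add: scaleR_eq_scaleQ[of _ "x \<odot> \<nu>"] scaleQ_scaleQ of_real_quat times_quat_def
            scaleR_quat_def mult.commute)
      ultimately show ?thesis
        using T by (simp add: Qop_apply y_def sphere_poly_def scaleQ_diff_left scaleQ_diff_right
            scaleQ_add_left scaleQ_add_right quat_ops_def blinfun.diff_right scaleQ_scaleQ power2_eq_square
            scaleR_eq_scaleQ[symmetric] scaleR_diff_right of_real_mult[symmetric] del: of_real_mult)
    qed
    then have "norm (Qop q T x) \<le> norm (x \<odot> sphere_poly q \<nu>) + norm (T y + y \<odot> \<nu> - (2 * qRe q) *\<^sub>R y)"
      by (metis norm_triangle_sub add.commute)
    also have "norm (T y + y \<odot> \<nu> - (2 * qRe q) *\<^sub>R y) \<le> norm (T y) + norm (y \<odot> \<nu>) + norm ((2 * qRe q) *\<^sub>R y)"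
      using norm_triangle_ineq norm_triangle_ineq4 by (smt (verit, best))
    also have "\<dots> \<le> B * norm y"
      using norm_blinfun[of T y] by (simp add: B_def norm_scaleQ algebra_simps abs_mult)
    also have "\<dots> \<le> B * (c * norm x)"
      using x B by (intro mult_left_mono) (auto simp: y_def)
    finally have "norm (Qop q T x) \<le> norm x * (norm (sphere_poly q \<nu>) + B * c)"
      by (simp add: norm_scaleQ algebra_simps)
    then have "norm x \<le> K * (norm x * (norm (sphere_poly q \<nu>) + B * c))"
      using K by (meson mult_left_mono order_trans)
    then have "norm x * 1 \<le> norm x * (K * norm (sphere_poly q \<nu>) + K * B * c)"
      by (simp add: algebra_simps)
    then have "1 \<le> K * norm (sphere_poly q \<nu>) + K * B * c"
      using x0 by (simp only: mult_le_cancel_left_pos)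
    moreover have "K * B * c \<le> e" using KB e by (simp add: c_def field_simps)
    ultimately show ?thesis by linarith
  qed
  then have "1 \<le> K * norm (sphere_poly q \<nu>)" by (rule field_le_epsilon)
  then show ?thesis using \<nu>(1) norm_sphere_poly_cnj by auto
qed

section \<open>Joint approximate eigenvectors\<close>

text \<open>
  A simultaneous approximate eigenvector principle: \<open>\<Phi>\<close> measures the failure to be an eigenvector of
  operators treated earlier, and \<open>M\<close> is the limit of \<open>sup \<parallel>C x\<parallel>\<close> over unit vectors with \<open>\<Phi> x < \<delta>\<close> as
  \<open>\<delta> \<rightarrow> 0\<close>. As \<open>C\<close> preserves smallness of \<open>\<Phi>\<close>, near-maximisers satisfy
  \<open>\<parallel>C' C x\<parallel> = \<parallel>C C x\<parallel> \<le> (M + o(1)) \<parallel>C x\<parallel>\<close>, which forces \<open>C' C x \<approx> M\<^sup>2 x\<close>.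
\<close>

lemma joint_approx_eigenvector_step:
  fixes C C' :: "'a::real_inner \<Rightarrow> 'a" and \<Phi> :: "'a \<Rightarrow> real"
  assumes adj: "\<And>x y. C' x \<bullet> y = x \<bullet> C y" and comm: "\<And>x. C (C' x) = C' (C x)"
    and bnd: "\<And>x. norm (C x) \<le> K * norm x" and scale: "\<And>r x. C (r *\<^sub>R x) = r *\<^sub>R C x"
    and \<Phi>_scale: "\<And>r x. \<Phi> (r *\<^sub>R x) = \<bar>r\<bar> * \<Phi> x" and \<Phi>_nonneg: "\<And>x. 0 \<le> \<Phi> x"
    and \<Phi>_bnd: "\<And>x. \<Phi> (C x) \<le> L * \<Phi> x"
    and approx: "\<And>\<delta>. 0 < \<delta> \<Longrightarrow> \<exists>x. norm x = 1 \<and> \<Phi> x < \<delta>"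
  obtains M where "0 \<le> M"
    "\<forall>\<eta>>0. \<exists>\<delta>>0. \<forall>x. norm x = 1 \<and> \<Phi> x < \<delta> \<longrightarrow> norm (C x) \<le> M + \<eta>"
    "\<forall>\<delta>>0. \<exists>x. norm x = 1 \<and> \<Phi> x < \<delta> \<and> norm (C' (C x) - M\<^sup>2 *\<^sub>R x) < \<delta>"
proof -
  define V where "V \<delta> = (norm \<circ> C) ` {x. norm x = 1 \<and> \<Phi> x < \<delta>}" for \<delta>
  define g where "g \<delta> = Sup (V \<delta>)" for \<delta>
  define M where "M = (INF \<delta>\<in>{0<..}. g \<delta>)"
  have Vne: "V \<delta> \<noteq> {}" if "0 < \<delta>" for \<delta> using approx[OF that] by (auto simp: V_def)
  have Vbd: "bdd_above (V \<delta>)" for \<delta>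
    unfolding V_def by (rule bdd_aboveI2[of _ _ K]) (use bnd in \<open>metis (mono_tags) comp_apply mem_Collect_eq mult.right_neutral\<close>)
  have le_g: "norm (C x) \<le> g \<delta>" if "norm x = 1" "\<Phi> x < \<delta>" for x \<delta>
    unfolding g_def by (rule cSup_upper[OF _ Vbd]) (use that in \<open>auto simp: V_def\<close>)
  have g0: "0 \<le> g \<delta>" if "0 < \<delta>" for \<delta>
    using approx[OF that] le_g norm_ge_zero order_trans by blast
  have bddg: "bdd_below (g ` {0<..})" by (rule bdd_belowI2[of _ 0]) (use g0 in auto)
  have M0: "0 \<le> M" unfolding M_def by (rule cINF_greatest) (use g0 in auto)
  have M_le: "M \<le> g \<delta>" if "0 < \<delta>" for \<delta>
    unfolding M_def by (rule cINF_lower[OF bddg]) (use that in simp)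
  have up: "\<exists>\<delta>>0. \<forall>x. norm x = 1 \<and> \<Phi> x < \<delta> \<longrightarrow> norm (C x) \<le> M + \<eta>" if "0 < \<eta>" for \<eta>
  proof -
    have "(INF \<delta>\<in>{0<..}. g \<delta>) < M + \<eta>" using that by (simp add: M_def)
    then obtain \<delta> where "\<delta> > 0" "g \<delta> < M + \<eta>" by (subst (asm) cINF_less_iff[OF _ bddg]) auto
    then show ?thesis using le_g by (meson less_imp_le order_trans)
  qed
  have low: "\<exists>x. norm x = 1 \<and> \<Phi> x < \<delta> \<and> M - \<eta> < norm (C x)" if "0 < \<delta>" "0 < \<eta>" for \<delta> \<eta>
  proof -
    have "M - \<eta> < Sup (V \<delta>)" using M_le[OF that(1)] that by (simp add: g_def)
    then show ?thesis by (subst (asm) less_cSup_iff[OF Vne[OF that(1)] Vbd]) (auto simp: V_def)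
  qed
  have CC: "norm (C' x) = norm (C x)" for x by (rule normal_norm_adjoint[OF adj comm])
  have main: "\<exists>x. norm x = 1 \<and> \<Phi> x < \<delta> \<and> norm (C' (C x) - M\<^sup>2 *\<^sub>R x) < \<delta>" if \<delta>: "0 < \<delta>" for \<delta>
  proof (cases "M = 0")
    \<comment> \<open>Here \<open>C x\<close> itself is small; no positive lower bound on
      \<open>norm (C x)\<close> is available for the normalisation used when
      \<open>M > 0\<close>.\<close>
    case True
    define \<eta> where "\<eta> = \<delta> / (\<bar>K\<bar> + 1)"
    have \<eta>: "0 < \<eta>" using \<delta> by (simp add: \<eta>_def)
    obtain \<delta>1 where \<delta>1: "0 < \<delta>1" "\<And>x. norm x = 1 \<Longrightarrow> \<Phi> x < \<delta>1 \<Longrightarrow> norm (C x) \<le> \<eta>"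
      using up[OF \<eta>] True by auto
    obtain x where x: "norm x = 1" "\<Phi> x < min \<delta> \<delta>1" using approx[of "min \<delta> \<delta>1"] \<delta> \<delta>1 by auto
    have "norm (C' (C x)) \<le> K * norm (C x)" using bnd CC by simp
    also have "\<dots> \<le> \<bar>K\<bar> * \<eta>" using \<delta>1(2)[of x] x by (intro mult_mono) auto
    also have "\<dots> < \<delta>" using \<delta> by (simp add: \<eta>_def field_simps)
    finally show ?thesis using x True by auto
  next
    case False
    then have M: "0 < M" using M0 by simp
    \<comment> \<open>\<open>h \<eta>\<close> bounds the square of
      \<open>norm (C' (C x) - M\<^sup>2 *\<^sub>R x)\<close> once M - \<eta> <
      \<open>norm (C x)\<close> and \<open>norm (C (C x))\<close> \<le> (M + \<eta>)^2.\<close>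
    define h where "h \<eta> = (M + \<eta>) ^ 4 - 2 * M\<^sup>2 * (M - \<eta>)\<^sup>2 + M ^ 4" for \<eta>
    have "(h \<longlongrightarrow> (M + 0) ^ 4 - 2 * M\<^sup>2 * (M - 0)\<^sup>2 + M ^ 4) (at_right 0)"
      unfolding h_def by (intro tendsto_intros)
    then have "(h \<longlongrightarrow> 0) (at_right 0)" by (simp add: power2_eq_square power4_eq_xxxx)
    then have "eventually (\<lambda>\<eta>. h \<eta> < \<delta>\<^sup>2) (at_right 0)"
      by (rule order_tendstoD) (use \<delta> in simp)
    moreover have "eventually (\<lambda>\<eta>. \<eta> \<in> {0<..<M}) (at_right 0)"
      using M by (rule eventually_at_right_real)
    ultimately have "eventually (\<lambda>\<eta>. h \<eta> < \<delta>\<^sup>2 \<and> \<eta> \<in> {0<..<M}) (at_right 0)"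
      by (rule eventually_conj)
    then obtain \<eta> where \<eta>: "h \<eta> < \<delta>\<^sup>2" "0 < \<eta>" "\<eta> < M"
      using eventually_happens[of _ "at_right (0::real)"] trivial_limit_at_right_real by force
    obtain \<delta>1 where \<delta>1: "0 < \<delta>1" "\<And>x. norm x = 1 \<Longrightarrow> \<Phi> x < \<delta>1 \<Longrightarrow> norm (C x) \<le> M + \<eta>"
      using up[OF \<eta>(2)] by auto
    \<comment> \<open>The last bound yields \<open>\<Phi> (C x) < \<delta>1 * norm (C x)\<close>, so
      the normalised image of \<open>x\<close> again satisfies the constraint for \<delta>1.\<close>
    define \<delta>2 where "\<delta>2 = min (min \<delta> \<delta>1) (\<delta>1 * (M - \<eta>) / (\<bar>L\<bar> + 1))"
    have "0 < \<delta>1 * (M - \<eta>) / (\<bar>L\<bar> + 1)" using \<delta>1 \<eta> by simp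
    then have "0 < \<delta>2" using \<delta> \<delta>1 by (simp add: \<delta>2_def)
    then obtain x where x: "norm x = 1" "\<Phi> x < \<delta>2" "M - \<eta> < norm (C x)"
      using low[of \<delta>2 \<eta>] \<eta> by blast
    have Cx: "norm (C x) \<le> M + \<eta>" using x \<delta>1(2)[of x] by (simp add: \<delta>2_def)
    have pos: "0 < norm (C x)" using x \<eta> by linarith
    have "\<Phi> (C x) \<le> \<bar>L\<bar> * \<Phi> x"
      using \<Phi>_bnd[of x] \<Phi>_nonneg[of x] by (meson abs_ge_self mult_right_mono order_trans)
    also have "\<dots> \<le> \<bar>L\<bar> * (\<delta>1 * (M - \<eta>) / (\<bar>L\<bar> + 1))"
      using x(2) by (intro mult_left_mono) (auto simp: \<delta>2_def)
    also have "\<dots> < \<delta>1 * (M - \<eta>)" using \<open>0 < \<delta>1 * (M - \<eta>) / (\<bar>L\<bar> + 1)\<close>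
      by (simp add: field_simps)
    also have "\<dots> < \<delta>1 * norm (C x)" using x \<delta>1 by simp
    finally have "\<Phi> (C x /\<^sub>R norm (C x)) < \<delta>1" using pos by (simp add: \<Phi>_scale field_simps)
    then have "norm (C (C x /\<^sub>R norm (C x))) \<le> M + \<eta>" using \<delta>1(2) pos by simp
    then have "norm (C (C x)) \<le> (M + \<eta>) * norm (C x)" using pos by (simp add: scale field_simps)
    also have "\<dots> \<le> (M + \<eta>) * (M + \<eta>)" using Cx M \<eta> by (intro mult_left_mono) auto
    finally have "(norm (C (C x)))\<^sup>2 \<le> ((M + \<eta>) * (M + \<eta>))\<^sup>2" by (rule power_mono) simp
    then have 1: "(norm (C (C x)))\<^sup>2 \<le> (M + \<eta>) ^ 4" by (simp add: power2_eq_square power4_eq_xxxx mult.assoc)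
    have "(M - \<eta>)\<^sup>2 \<le> (norm (C x))\<^sup>2" using x \<eta> by (intro power_mono) auto
    then have 2: "2 * M\<^sup>2 * (M - \<eta>)\<^sup>2 \<le> 2 * M\<^sup>2 * (norm (C x))\<^sup>2" by (intro mult_left_mono) auto
    have "x \<bullet> x = 1" using x by (simp flip: power2_norm_eq_inner)
    then have "(norm (C' (C x) - M\<^sup>2 *\<^sub>R x))\<^sup>2 = (norm (C' (C x)))\<^sup>2 - 2 * M\<^sup>2 * (norm (C x))\<^sup>2 + M ^ 4"
      unfolding power2_norm_eq_inner using adj[of "C x" x]
      by (simp add: inner_diff inner_commute algebra_simps power2_eq_square power4_eq_xxxx)
    also have "\<dots> \<le> h \<eta>" using 1 2 by (simp add: h_def CC)
    finally have "(norm (C' (C x) - M\<^sup>2 *\<^sub>R x))\<^sup>2 < \<delta>\<^sup>2" using \<eta> by simp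
    then have "norm (C' (C x) - M\<^sup>2 *\<^sub>R x) < \<delta>" using \<delta> by (simp add: power_less_imp_less_base)
    then show ?thesis using x by (auto simp: \<delta>2_def)
  qed
  show thesis by (rule that[OF M0]) (use up main in blast)+
qed

section \<open>A spectral point with |p(\<mu>)| at most 1 / |N|\<close>

text \<open>
  The polynomial in \<open>a\<close> and \<open>s\<close> below is \<open>|p(\<mu>)|\<^sup>2\<close> for \<open>|\<mu>|\<^sup>2 = s\<close>, \<open>Re(\<mu>) = a\<close>, since then
  \<open>p(\<mu>) = (2 a - 2 Re(q)) \<mu> + (|q|\<^sup>2 - s)\<close>.
\<close>

lemma normal_Qop_inverse_norm_attained:
  fixes T T' N :: "'a::quat_hilbert_space \<Rightarrow>\<^sub>L 'a"
  assumes ex: "\<exists>x::'a. x \<noteq> 0"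
    and adj: "\<And>x y. T' x \<bullet> y = x \<bullet> T y" and comm: "\<And>x. T (T' x) = T' (T x)"
    and NQ: "\<And>x. N (Qop q T x) = x" and QN: "\<And>x. Qop q T (N x) = x"
  obtains a s where "a\<^sup>2 \<le> s"
    "\<And>\<delta>. 0 < \<delta> \<Longrightarrow> \<exists>x. norm x = 1 \<and> norm (T (T x) - (2 * a) *\<^sub>R T x + s *\<^sub>R x) < \<delta>"
    "(norm N)\<^sup>2 * ((2 * a - 2 * qRe q)\<^sup>2 * s + 2 * (2 * a - 2 * qRe q) * ((norm q)\<^sup>2 - s) * a
       + ((norm q)\<^sup>2 - s)\<^sup>2) \<le> 1"
proof -
  note Q_simps = blinfun.add_right blinfun.diff_right blinfun.scaleR_right
  let ?Q = "Qop q T" and ?Q' = "Qop q T'"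
  obtain u :: 'a where u: "norm u = 1" using ex by (metis norm_sgn)
  obtain N' :: "'a \<Rightarrow>\<^sub>L 'a" where N': "\<And>x y. N' x \<bullet> y = x \<bullet> N y" using adjoint_exists[of N] by blast
  have Qadj: "?Q' x \<bullet> y = x \<bullet> ?Q y" for x y by (rule Qop_adjoint[OF adj])
  have Qcomm: "?Q (?Q' x) = ?Q' (?Q x)" for x by (rule Qop_commute[OF comm])
  have N'Q': "N' (?Q' x) = x" for x by (subst vector_eq_rdot[symmetric]) (simp add: N' Qadj QN)
  have Q'N': "?Q' (N' x) = x" for x by (subst vector_eq_rdot[symmetric]) (simp add: N' Qadj NQ)
  \<comment> \<open>Normality passes to the inverse: swap \<open>?Q\<close> and \<open>?Q'\<close>
    in front of \<open>N' (N x)\<close>, then cancel.\<close>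
  have Ncomm: "N (N' x) = N' (N x)" for x
  proof -
    have "x = ?Q (?Q' (N' (N x)))" by (simp add: Q'N' QN)
    also have "\<dots> = ?Q' (?Q (N' (N x)))" by (rule Qcomm)
    finally have "N (N' x) = N (N' (?Q' (?Q (N' (N x)))))" by (rule arg_cong)
    then show ?thesis by (simp add: N'Q' NQ)
  qed
  have TQ: "T (?Q x) = ?Q (T x)" "T (?Q' x) = ?Q' (T x)" for x
    by (simp_all add: Qop_apply Q_simps comm)
  have TN: "N (T x) = T (N x)" for x by (metis NQ QN TQ(1))
  have TN': "N' (T x) = T (N' x)" for x by (metis N'Q' Q'N' TQ(2))

  \<comment> \<open>First round, with zero constraint: every unit vector is admissible, so
    \<open>M\<close> will bound \<open>norm N\<close>.\<close>
  obtain M where M: "0 \<le> M" "\<forall>\<eta>>0. \<exists>\<delta>>0. \<forall>x. norm x = 1 \<and> 0 < (\<delta>::real) \<longrightarrow> norm (N x) \<le> M + \<eta>"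
    "\<forall>\<delta>>0. \<exists>x. norm x = 1 \<and> 0 < \<delta> \<and> norm (N' (N x) - M\<^sup>2 *\<^sub>R x) < \<delta>"
  proof (rule joint_approx_eigenvector_step[of N' N "norm N" "\<lambda>_. 0" 0,
        OF N' Ncomm norm_blinfun blinfun.scaleR_right])
    show "\<exists>x::'a. norm x = 1 \<and> 0 < \<delta>" if "0 < \<delta>" for \<delta> :: real
      using u that by blast
  qed (simp, simp, simp, rule that)
  have "norm (N x) \<le> M * norm x" for x
  proof -
    have "norm (N x) \<le> M" if "norm x = 1" for x
      by (rule field_le_epsilon) (use M(2) that in blast)
    from this[of "x /\<^sub>R norm x"] show ?thesis
      by (cases "x = 0") (auto simp: blinfun.scaleR_right field_simps)
  qed
  then have NM: "norm N \<le> M" using M(1) by (intro norm_blinfun_bound) auto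

  \<comment> \<open>The defect of \<open>x\<close> as an eigenvector of N'N. Since \<open>T\<close>
    commutes with \<open>N\<close> and \<open>N'\<close>, it can serve as the constraint in the
    round for \<open>T\<close>.\<close>
  define \<Phi>1 where "\<Phi>1 x = norm (N' (N x) - M\<^sup>2 *\<^sub>R x)" for x
  have \<Phi>1_scale: "\<Phi>1 (r *\<^sub>R x) = \<bar>r\<bar> * \<Phi>1 x" for r x
  proof -
    have "N' (N (r *\<^sub>R x)) - M\<^sup>2 *\<^sub>R (r *\<^sub>R x) = r *\<^sub>R (N' (N x) - M\<^sup>2 *\<^sub>R x)"
      by (simp add: blinfun.scaleR_right scaleR_diff_right mult.commute)
    then show ?thesis by (simp add: \<Phi>1_def)
  qed
  have \<Phi>1_T: "\<Phi>1 (T x) \<le> norm T * \<Phi>1 x" for x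
    using norm_blinfun[of T "N' (N x) - M\<^sup>2 *\<^sub>R x"] by (simp add: \<Phi>1_def TN TN' Q_simps)
  obtain m where m: "\<forall>\<delta>>0. \<exists>x. norm x = 1 \<and> \<Phi>1 x < \<delta> \<and> norm (T' (T x) - m\<^sup>2 *\<^sub>R x) < \<delta>"
  proof (rule joint_approx_eigenvector_step[of T' T "norm T" \<Phi>1 "norm T",
        OF adj comm norm_blinfun blinfun.scaleR_right \<Phi>1_scale _ \<Phi>1_T])
    show "\<exists>x. norm x = 1 \<and> \<Phi>1 x < \<delta>" if "0 < \<delta>" for \<delta>
      using M(3) that by (auto simp: \<Phi>1_def)
  qed (simp add: \<Phi>1_def, rule that)

  define \<Phi>2 where "\<Phi>2 x = \<Phi>1 x + norm (T' (T x) - m\<^sup>2 *\<^sub>R x)" for x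
  \<comment> \<open>C'C expands to T'T + (T + T') + 1, so with T'T known it determines T + T'.
    Treating T + T' directly would give only the square of its eigenvalue and lose the sign.\<close>
  define C where "C x = T x + x" for x
  define C' where "C' x = T' x + x" for x
  have \<Phi>1_C: "\<Phi>1 (C x) \<le> (norm T + 1) * \<Phi>1 x" for x
  proof -
    have "N' (N (C x)) - M\<^sup>2 *\<^sub>R C x = (N' (N (T x)) - M\<^sup>2 *\<^sub>R T x) + (N' (N x) - M\<^sup>2 *\<^sub>R x)"
      by (simp add: C_def Q_simps algebra_simps)
    then have "\<Phi>1 (C x) \<le> \<Phi>1 (T x) + \<Phi>1 x" by (simp add: \<Phi>1_def norm_triangle_ineq)
    then show ?thesis using \<Phi>1_T[of x] by (simp add: algebra_simps)
  qed
  have \<Phi>2_C: "\<Phi>2 (C x) \<le> (norm T + 1) * \<Phi>2 x" for x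
  proof -
    have "T' (T (C x)) - m\<^sup>2 *\<^sub>R C x = T (T' (T x) - m\<^sup>2 *\<^sub>R x) + (T' (T x) - m\<^sup>2 *\<^sub>R x)"
      by (simp add: C_def Q_simps comm algebra_simps)
    then have "norm (T' (T (C x)) - m\<^sup>2 *\<^sub>R C x)
        \<le> norm T * norm (T' (T x) - m\<^sup>2 *\<^sub>R x) + norm (T' (T x) - m\<^sup>2 *\<^sub>R x)"
      using norm_blinfun[of T "T' (T x) - m\<^sup>2 *\<^sub>R x"]
        norm_triangle_ineq[of "T (T' (T x) - m\<^sup>2 *\<^sub>R x)" "T' (T x) - m\<^sup>2 *\<^sub>R x"] by simp
    then show ?thesis using \<Phi>1_C[of x] by (simp add: \<Phi>2_def algebra_simps)
  qed
  have \<Phi>2_scale: "\<Phi>2 (r *\<^sub>R x) = \<bar>r\<bar> * \<Phi>2 x" for r x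
  proof -
    have "T' (T (r *\<^sub>R x)) - m\<^sup>2 *\<^sub>R (r *\<^sub>R x) = r *\<^sub>R (T' (T x) - m\<^sup>2 *\<^sub>R x)"
      by (simp add: blinfun.scaleR_right scaleR_diff_right mult.commute)
    then show ?thesis by (simp add: \<Phi>2_def \<Phi>1_scale distrib_left)
  qed
  have \<Phi>2_approx: "\<exists>x. norm x = 1 \<and> \<Phi>2 x < \<delta>" if \<delta>: "0 < \<delta>" for \<delta>
  proof -
    obtain x where "norm x = 1" "\<Phi>1 x < \<delta> / 2" "norm (T' (T x) - m\<^sup>2 *\<^sub>R x) < \<delta> / 2"
      using m[rule_format, of "\<delta> / 2"] \<delta> by auto
    then show ?thesis unfolding \<Phi>2_def by (intro exI[of _ x]) linarith
  qed
  have C_bnd: "norm (C x) \<le> (norm T + 1) * norm x" for x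
    using norm_triangle_ineq[of "T x" x] norm_blinfun[of T x] by (simp add: C_def algebra_simps)
  obtain k where k: "\<forall>\<delta>>0. \<exists>x. norm x = 1 \<and> \<Phi>2 x < \<delta> \<and> norm (C' (C x) - k\<^sup>2 *\<^sub>R x) < \<delta>"
  proof (rule joint_approx_eigenvector_step[of C' C "norm T + 1" \<Phi>2 "norm T + 1",
        OF _ _ C_bnd _ \<Phi>2_scale _ \<Phi>2_C \<Phi>2_approx])
    show "C' x \<bullet> y = x \<bullet> C y" for x y by (simp add: C_def C'_def adj inner_add)
    show "C (C' x) = C' (C x)" "C (r *\<^sub>R x) = r *\<^sub>R C x" for x r
      by (simp_all add: C_def C'_def Q_simps comm scaleR_add_right)
    show "0 \<le> \<Phi>2 x" for x by (simp add: \<Phi>2_def \<Phi>1_def)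
  qed (assumption, rule that)

  have "\<exists>x. norm x = 1 \<and> \<Phi>2 x < 1 / real (Suc n) \<and> norm (C' (C x) - k\<^sup>2 *\<^sub>R x) < 1 / real (Suc n)" for n
    using k[rule_format, of "1 / real (Suc n)"] by simp
  then obtain X where X: "\<And>n. norm (X n) = 1" "\<And>n. \<Phi>2 (X n) < 1 / real (Suc n)"
    "\<And>n. norm (C' (C (X n)) - k\<^sup>2 *\<^sub>R X n) < 1 / real (Suc n)" by metis
  define s where "s = m\<^sup>2"
  define a where "a = (k\<^sup>2 - s - 1) / 2"
  have k2: "k\<^sup>2 = 2 * a + s + 1" by (simp add: a_def field_simps)
  have XX: "X n \<bullet> X n = 1" for n using X(1)[of n] by (simp flip: power2_norm_eq_inner)
  have e1: "(\<lambda>n. N' (N (X n)) - M\<^sup>2 *\<^sub>R X n) \<longlonglongrightarrow> 0" and e2: "(\<lambda>n. T' (T (X n)) - s *\<^sub>R X n) \<longlonglongrightarrow> 0"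
  proof -
    have "norm (N' (N (X n)) - M\<^sup>2 *\<^sub>R X n) < 1 / real (Suc n) \<and> norm (T' (T (X n)) - s *\<^sub>R X n) < 1 / real (Suc n)" for n
      using X(2)[of n] norm_ge_zero[of "N' (N (X n)) - M\<^sup>2 *\<^sub>R X n"] norm_ge_zero[of "T' (T (X n)) - s *\<^sub>R X n"]
      unfolding \<Phi>2_def \<Phi>1_def s_def by linarith
    then show "(\<lambda>n. N' (N (X n)) - M\<^sup>2 *\<^sub>R X n) \<longlonglongrightarrow> 0" "(\<lambda>n. T' (T (X n)) - s *\<^sub>R X n) \<longlonglongrightarrow> 0"
      by (auto intro: LIMSEQ_norm_0)
  qed
  have e3: "(\<lambda>n. C' (C (X n)) - k\<^sup>2 *\<^sub>R X n) \<longlonglongrightarrow> 0"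
    by (rule LIMSEQ_norm_0) (use X(3) in auto)
  have "C' (C x) - k\<^sup>2 *\<^sub>R x - (T' (T x) - s *\<^sub>R x) = T' x + T x - (2 * a) *\<^sub>R x" for x
    by (simp add: C_def C'_def Q_simps k2 algebra_simps)
  then have e4: "(\<lambda>n. T' (X n) + T (X n) - (2 * a) *\<^sub>R X n) \<longlonglongrightarrow> 0"
    using tendsto_diff[OF e3 e2] by simp
  \<comment> \<open>Applying \<open>T\<close> to the defect of T + T' and subtracting that of T'T
    eliminates T'.\<close>
  have eq5: "T (T' x + T x - (2 * a) *\<^sub>R x) - (T' (T x) - s *\<^sub>R x) = T (T x) - (2 * a) *\<^sub>R T x + s *\<^sub>R x" for x
    by (simp add: Q_simps comm algebra_simps)
  have e5: "(\<lambda>n. T (T (X n)) - (2 * a) *\<^sub>R T (X n) + s *\<^sub>R X n) \<longlonglongrightarrow> 0"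
    using tendsto_diff[OF blinfun.tendsto[OF tendsto_const[of T] e4] e2]
    by (simp only: eq5 blinfun.zero_right diff_zero)
  \<comment> \<open>Undoing N'N in its eigenvector relation; pairing with \<open>X n\<close> will
    give the limit 1 for \<open>M\<^sup>2 * (norm (?Q (X n)))\<^sup>2\<close>.\<close>
  have eq6: "?Q' (?Q (N' (N x) - M\<^sup>2 *\<^sub>R x)) = x - M\<^sup>2 *\<^sub>R ?Q' (?Q x)" for x
    by (simp only: blinfun.diff_right blinfun.scaleR_right) (simp add: Qcomm[symmetric] Q'N' QN)
  have e6: "(\<lambda>n. X n - M\<^sup>2 *\<^sub>R ?Q' (?Q (X n))) \<longlonglongrightarrow> 0"
    using blinfun.tendsto[OF tendsto_const[of ?Q'] blinfun.tendsto[OF tendsto_const[of ?Q] e1]]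
    by (simp only: eq6 blinfun.zero_right)

  have inner_null: "(\<lambda>n. E n \<bullet> X n) \<longlonglongrightarrow> 0" if "E \<longlonglongrightarrow> 0" for E
  proof (rule Lim_null_comparison)
    have "norm (E n \<bullet> X n) \<le> norm (E n)" for n
      using Cauchy_Schwarz_ineq2[of "E n" "X n"] X(1) by simp
    then show "\<forall>\<^sub>F n in sequentially. norm (E n \<bullet> X n) \<le> norm (E n)" by simp
    show "(\<lambda>n. norm (E n)) \<longlonglongrightarrow> 0" using that by (rule tendsto_norm_zero)
  qed
  have i1: "(\<lambda>n. (norm (T (X n)))\<^sup>2) \<longlonglongrightarrow> s"
    using tendsto_add[OF inner_null[OF e2] tendsto_const[of s]]
    by (simp add: inner_diff adj X(1) flip: power2_norm_eq_inner)
  have i2: "(\<lambda>n. T (X n) \<bullet> X n) \<longlonglongrightarrow> a"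
    using tendsto_mult_left[OF tendsto_add[OF inner_null[OF e4] tendsto_const[of "2 * a"]], of "1 / 2"]
    by (simp add: inner_add inner_diff adj XX inner_commute[of "X _" "T _"])
  have i6: "(\<lambda>n. M\<^sup>2 * (norm (?Q (X n)))\<^sup>2) \<longlonglongrightarrow> 1"
    using tendsto_diff[OF tendsto_const[of 1] inner_null[OF e6]]
    by (simp add: inner_diff Qadj X(1) flip: power2_norm_eq_inner)
  have as: "a\<^sup>2 \<le> s"
  proof (rule LIMSEQ_le[OF tendsto_power[OF i2] i1])
    have "(T (X n) \<bullet> X n)\<^sup>2 \<le> (norm (T (X n)))\<^sup>2" for n
      using Cauchy_Schwarz_ineq[of "T (X n)" "X n"] by (simp add: XX power2_norm_eq_inner)
    then show "\<exists>N. \<forall>n\<ge>N. (T (X n) \<bullet> X n)\<^sup>2 \<le> (norm (T (X n)))\<^sup>2" by blast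
  qed

  define c where "c = 2 * a - 2 * qRe q"
  define d where "d = (norm q)\<^sup>2 - s"
  define P where "P = c\<^sup>2 * s + 2 * c * d * a + d\<^sup>2"
  \<comment> \<open>The remainder of p(T) modulo T^2 - 2 a T + s, applied to \<open>X n\<close>; its
    limiting norm is determined by \<open>i1\<close> and \<open>i2\<close>.\<close>
  define v where "v n = c *\<^sub>R T (X n) + d *\<^sub>R X n" for n
  have "(norm (v n))\<^sup>2 = c\<^sup>2 * (norm (T (X n)))\<^sup>2 + 2 * c * d * (T (X n) \<bullet> X n) + d\<^sup>2" for n
    unfolding power2_norm_eq_inner v_def
    by (simp add: inner_add XX inner_commute[of "X n" "T (X n)"] algebra_simps power2_eq_square)
  then have v2: "(\<lambda>n. (norm (v n))\<^sup>2) \<longlonglongrightarrow> P"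
    unfolding P_def by (auto intro!: tendsto_intros i1 i2)
  have "0 \<le> P" by (rule LIMSEQ_le_const[OF v2]) auto
  have v1: "(\<lambda>n. norm (v n)) \<longlonglongrightarrow> sqrt P"
    using tendsto_real_sqrt[OF v2] by simp
  have "?Q (X n) - v n = T (T (X n)) - (2 * a) *\<^sub>R T (X n) + s *\<^sub>R X n" for n
    by (simp add: v_def c_def d_def Qop_apply algebra_simps)
  then have "(\<lambda>n. ?Q (X n) - v n) \<longlonglongrightarrow> 0" using e5 by simp
  then have "(\<lambda>n. norm (?Q (X n)) - norm (v n)) \<longlonglongrightarrow> 0"
    by (rule tendsto_norm_zero[THEN Lim_null_comparison[rotated]])
       (auto intro!: always_eventually norm_triangle_ineq3)
  then have "(\<lambda>n. norm (?Q (X n))) \<longlonglongrightarrow> sqrt P"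
    using tendsto_add[OF _ v1] by fastforce
  then have "(\<lambda>n. M\<^sup>2 * (norm (?Q (X n)))\<^sup>2) \<longlonglongrightarrow> M\<^sup>2 * (sqrt P)\<^sup>2"
    by (intro tendsto_intros)
  then have "M\<^sup>2 * P = 1"
    using LIMSEQ_unique[OF i6] \<open>0 \<le> P\<close> by simp
  moreover have "(norm N)\<^sup>2 * P \<le> M\<^sup>2 * P"
    using NM \<open>0 \<le> P\<close> by (intro mult_right_mono power_mono) auto
  ultimately have "(norm N)\<^sup>2 * P \<le> 1" by simp
  moreover have "\<exists>x. norm x = 1 \<and> norm (T (T x) - (2 * a) *\<^sub>R T x + s *\<^sub>R x) < \<delta>" if "0 < \<delta>" for \<delta>
    using LIMSEQ_D[OF e5 that] X(1) by auto
  ultimately show thesis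
    using that[of a s] as by (simp add: P_def c_def d_def)
qed

section \<open>Comparison of the sphere with the pseudo S-spectrum\<close>

theorem theorem4p8:
  fixes T :: "'a::quat_hilbert_space \<Rightarrow>\<^sub>L 'a" and \<epsilon> :: real
  assumes "\<exists>x::'a. x \<noteq> 0"
    and "T \<in> quat_ops"
    and "qnormal T"
    and "\<epsilon> > 0"
  shows "S_sphere (S_spectrum T) \<epsilon> = pseudo_S_spectrum \<epsilon> T"
proof -
  note T = assms(2)
  define T' where "T' = qadjoint T"
  have "qinner (T' x) y = qinner x (T y)" for x y
    using is_qadjoint_qadjoint[OF T] by (simp add: is_qadjoint_def T'_def)
  then have adj: "T' x \<bullet> y = x \<bullet> T y" for x y by (simp add: inner_eq_qRe_qinner)
  have comm: "T (T' x) = T' (T x)" for x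
    using assms(3) unfolding qnormal_def T'_def by (metis blinfun_apply_blinfun_compose)
  have spec: "\<mu> \<in> S_spectrum T \<longleftrightarrow> (\<forall>\<delta>>0. \<exists>x. norm x = 1 \<and> norm (Qop \<mu> T x) < \<delta>)" for \<mu>
    using not_op_invertible_Qop_iff[OF T adj comm] by (simp add: S_spectrum_def)
  let ?P = "\<lambda>q. INF \<mu>\<in>S_spectrum T \<inter> qcomplex. ereal (norm (sphere_poly q \<mu>))"
  have "?P q \<le> ereal \<epsilon> \<longleftrightarrow> q \<in> S_spectrum T \<or> 1 / \<epsilon> \<le> norm (op_inverse (Qop q T))" for q
  proof (cases "q \<in> S_spectrum T")
    case True
    \<comment> \<open>A complex point with the real part and modulus of \<open>q\<close>: it has the
      same \<open>Qop\<close> and is a root of p, so the infimum is at most 0.\<close>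
    define \<mu> where "\<mu> = Quat (qRe q) (sqrt ((qI q)\<^sup>2 + (qJ q)\<^sup>2 + (qK q)\<^sup>2)) 0 0"
    have "Qop \<mu> T = Qop q T" by (simp add: Qop_def \<mu>_def norm_quat_def)
    then have "\<mu> \<in> S_spectrum T \<inter> qcomplex" using True by (simp add: S_spectrum_def qcomplex_def \<mu>_def)
    moreover have "sphere_poly q \<mu> = 0"
      by (simp add: sphere_poly_def \<mu>_def quat_eq_iff of_real_quat norm_quat_def power2_eq_square[of "Quat _ _ _ _"]
          times_quat_def minus_quat_def plus_quat_def scaleR_quat_def zero_quat_def)
         (simp add: power2_eq_square)
    ultimately have "?P q \<le> ereal 0"
      using INF_lower[of \<mu> "S_spectrum T \<inter> qcomplex" "\<lambda>\<mu>. ereal (norm (sphere_poly q \<mu>))"] by simp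
    also have "\<dots> \<le> ereal \<epsilon>" using assms(4) by simp
    finally show ?thesis using True by simp
  next
    case False
    then obtain N where "is_op_inverse (Qop q T) N" by (auto simp: S_spectrum_def op_invertible_def)
    then have N: "op_inverse (Qop q T) = N" "\<And>x. N (Qop q T x) = x" "\<And>x. Qop q T (N x) = x"
      by (auto simp: op_inverse_eq is_op_inverse_def)
         (metis blinfun_apply_blinfun_compose blinfun_apply_id_blinfun)+
    obtain u :: 'a where u: "norm u = 1" using assms(1) by (metis norm_sgn)
    have "norm x \<le> norm N * norm (Qop q T x)" for x
      using norm_blinfun[of N "Qop q T x"] by (simp add: N)
    then have ge: "1 \<le> norm N * norm (sphere_poly q \<mu>)" if "\<mu> \<in> S_spectrum T" for \<mu>
      using norm_sphere_poly_ge[OF T _ norm_ge_zero] that spec by blast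
    have N0: "0 < norm N" using N(2)[of u] u by auto
    have "1 / \<epsilon> \<le> norm N" if "?P q \<le> ereal \<epsilon>"
    proof -
      \<comment> \<open>Every term is at least \<open>1 / norm N\<close> by \<open>ge\<close>; an
        infimum over no terms would be infinite.\<close>
      have "ereal (1 / norm N) \<le> ?P q"
        by (rule INF_greatest) (use ge N0 in \<open>auto simp: field_simps\<close>)
      also note that
      finally have "1 / norm N \<le> \<epsilon>" by simp
      then show ?thesis using N0 assms(4) by (simp add: field_simps)
    qed
    moreover have "?P q \<le> ereal \<epsilon>" if le: "1 / \<epsilon> \<le> norm N"
    proof -
      obtain a s where as: "a\<^sup>2 \<le> s"
        "\<And>\<delta>. 0 < \<delta> \<Longrightarrow> \<exists>x. norm x = 1 \<and> norm (T (T x) - (2 * a) *\<^sub>R T x + s *\<^sub>R x) < \<delta>"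
        "(norm N)\<^sup>2 * ((2 * a - 2 * qRe q)\<^sup>2 * s + 2 * (2 * a - 2 * qRe q) * ((norm q)\<^sup>2 - s) * a
           + ((norm q)\<^sup>2 - s)\<^sup>2) \<le> 1"
        using normal_Qop_inverse_norm_attained[OF assms(1) adj comm N(2,3)] by blast
      \<comment> \<open>\<mu> = a + i b has real part a and squared modulus s, so
        \<open>Qop \<mu> T x\<close> is the expression in \<open>as(2)\<close>, which puts \<mu> in
        the S-spectrum.\<close>
      define b where "b = sqrt (s - a\<^sup>2)"
      define \<mu> where "\<mu> = Quat a b 0 0"
      have b: "s = a\<^sup>2 + b\<^sup>2" using as(1) by (simp add: b_def)
      have n\<mu>: "(norm \<mu>)\<^sup>2 = s" by (simp add: \<mu>_def norm_quat_def b)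
      have "\<mu> \<in> S_spectrum T \<inter> qcomplex"
        using as(2) by (simp add: spec Qop_apply n\<mu>) (simp add: \<mu>_def qcomplex_def)
      then have 1: "?P q \<le> ereal (norm (sphere_poly q \<mu>))" by (rule INF_lower)
      have sp: "sphere_poly q \<mu> = Quat (a\<^sup>2 - b\<^sup>2 - 2 * qRe q * a + (norm q)\<^sup>2) (2 * (a - qRe q) * b) 0 0"
        by (simp add: sphere_poly_def \<mu>_def quat_eq_iff of_real_quat power2_eq_square[of "Quat _ _ _ _"]
          times_quat_def minus_quat_def plus_quat_def scaleR_quat_def)
         (simp add: power2_eq_square algebra_simps)
      have "(norm (sphere_poly q \<mu>))\<^sup>2 = (2 * a - 2 * qRe q)\<^sup>2 * s
          + 2 * (2 * a - 2 * qRe q) * ((norm q)\<^sup>2 - s) * a + ((norm q)\<^sup>2 - s)\<^sup>2"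
        unfolding sp norm_quat_def[of "Quat _ _ _ _"] b by simp algebra
      then have "(norm N * norm (sphere_poly q \<mu>))\<^sup>2 \<le> 1\<^sup>2"
        using as(3) by (simp add: power_mult_distrib)
      then have "norm N * norm (sphere_poly q \<mu>) \<le> 1" by (rule power2_le_imp_le) simp
      moreover have "1 \<le> \<epsilon> * norm N" using le assms(4) by (simp add: field_simps)
      ultimately have "norm N * norm (sphere_poly q \<mu>) \<le> norm N * \<epsilon>" by (simp add: mult.commute)
      then have "norm (sphere_poly q \<mu>) \<le> \<epsilon>" using N0 by simp
      then show ?thesis by (intro order_trans[OF 1]) simp
    qed
    ultimately show ?thesis using False N(1) by auto
  qed
  then show ?thesis
    by (auto simp: S_sphere_def pseudo_S_spectrum_def sphere_poly_def)
qed

end
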